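(* Let $X$ be a stationary Poisson process in $\mathbb{R}^d$. Then $J_W(r) = 1$ for every compact set $W\subset\mathbb{R}^d$ with nonempty interior and every $r\ge 0$.
   Context: Let $X$ be a stationary point process in $\mathbb{R}^d$ with intensity $\lambda\in(0,\infty)$, regarded as a random locally finite subset of $\mathbb{R}^d$ (i.e. a simple point process). Let $\mathbb{P}$ denote its distribution and $\mathbb{P}^{0!}$ its reduced Palm distribution at the origin $0$ (the distribution of $X\setminus\{0\}$ under the Palm distribution at $0$). $B(x,r)$ is the closed ball of radius $r$ centred at $x$. For every compact set $K\subset\mathbb{R}^d$ containing the origin define $$\mathbb{F}(K):=\mathbb{P}(X\cap K\neq\emptyset),\qquad \mathbb{G}(K):=\mathbb{P}^{0!}(X\cap K\neq\emptyset).$$ For a compact set $W\subset\mathbb{R}^d$ with nonempty interior, the window based $J$ function is $$J_W(r):=\frac{\int_W[1-\mathbb{G}(B(0,r)\cap W_{-x})]\,dx}{\int_W[1-\mathbb{F}(B(0,r)\cap W_{-x})]\,dx},\qquad W_{-x}=\{y-x:y\in W\}.$$ *)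

theory Defs
  imports "HOL-Probability.Probability"
begin

section \<open>Point processes as random locally finite sets\<close>

definition locally_finite :: "'a::euclidean_space set \<Rightarrow> bool" where
  "locally_finite S \<longleftrightarrow> (\<forall>K. compact K \<longrightarrow> finite (S \<inter> K))"

text \<open>The space of locally finite sets with the usual \<open>\<sigma>\<close>-algebra, which is generated by the
  counting maps of bounded Borel sets. (The measure that \<^const>\<open>sigma\<close> puts on it is
  irrelevant; only the \<open>\<sigma>\<close>-algebra is used.)\<close>

definition configs :: "'a::euclidean_space set measure" where
  "configs = sigma {S. locally_finite S}
     {{S. locally_finite S \<and> card (S \<inter> B) = n} | B n. B \<in> sets borel \<and> bounded B}"

lemma space_configs: "space configs = {S. locally_finite S}"
  unfolding configs_def by (rule space_measure_of) auto

lemma sets_configs: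
  "sets configs = sigma_sets {S. locally_finite S}
     {{S. locally_finite S \<and> card (S \<inter> B) = n} | B n. B \<in> sets borel \<and> bounded B}"
  unfolding configs_def by (rule sets_measure_of) auto

lemma locally_finite_bounded:
  assumes "locally_finite S" "bounded B"
  shows "finite (S \<inter> B)"
proof -
  have "finite (S \<inter> closure B)"
    using assms unfolding locally_finite_def by (simp add: compact_closure)
  then show ?thesis
    by (rule finite_subset[rotated]) (use closure_subset in auto)
qed

lemma measurable_card_configs:
  assumes "B \<in> sets borel" "bounded B"
  shows "(\<lambda>S. card (S \<inter> B)) \<in> measurable configs (count_space (UNIV :: nat set))"
proof (rule measurable_count_space_eq2_countable[THEN iffD2, rule_format], simp_all, intro allI)
  fix n
  have "(\<lambda>S. card (S \<inter> B)) -` {n} \<inter> space configs = {S. locally_finite S \<and> card (S \<inter> B) = n}"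
    by (auto simp: space_configs)
  also have "\<dots> \<in> sets configs"
    unfolding sets_configs using assms by (intro sigma_sets.Basic) blast
  finally show "(\<lambda>S. card (S \<inter> B)) -` {n} \<inter> space configs \<in> sets configs" .
qed

lemma measurable_card_section:
  fixes h :: "'b \<Rightarrow> 'a::euclidean_space set"
  assumes C: "C \<in> sets borel" "bounded C" and h: "h \<in> measurable L configs"
    and Q: "Q \<in> sets (L \<Otimes>\<^sub>M borel)"
  shows "(\<lambda>\<omega>. real (card {x \<in> h \<omega> \<inter> C. (\<omega>, x) \<in> Q})) \<in> borel_measurable L"
proof -
  let ?G = "{a \<times> b | a b. a \<in> sets L \<and> b \<in> sets (borel :: 'a measure)}"
  let ?O = "space L \<times> space (borel :: 'a measure)"
  let ?f = "\<lambda>Q \<omega>. real (card {x \<in> h \<omega> \<inter> C. (\<omega>, x) \<in> Q})"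
  have fin: "finite (h \<omega> \<inter> C)" if "\<omega> \<in> space L" for \<omega>
    using measurable_space[OF h that] C by (simp add: space_configs locally_finite_bounded)
  have full: "(\<lambda>\<omega>. real (card (h \<omega> \<inter> B))) \<in> borel_measurable L"
    if "B \<in> sets borel" "bounded B" for B :: "'a set"
    by (rule measurable_compose[OF h measurable_compose[OF measurable_card_configs[OF that]]]) simp
  have "Int_stable ?G" by (rule Int_stable_pair_measure_generator)
  moreover have "?G \<subseteq> Pow ?O"
    by (rule pair_measure_closed)
  moreover have "Q \<in> sigma_sets ?O ?G"
    using Q by (simp add: sets_pair_measure)
  ultimately show ?thesis
  proof (induction rule: sigma_sets_induct_disjoint)
    case (basic R)
    then obtain a b where R: "R = a \<times> b" "a \<in> sets L" "b \<in> sets borel" by auto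
    have "?f R \<omega> = indicator a \<omega> * real (card (h \<omega> \<inter> (C \<inter> b)))" for \<omega>
    proof (cases "\<omega> \<in> a")
      case True
      then have "{x \<in> h \<omega> \<inter> C. (\<omega>, x) \<in> R} = h \<omega> \<inter> (C \<inter> b)" using R by auto
      then show ?thesis using True by simp
    qed (simp add: R)
    moreover have "(\<lambda>\<omega>. indicator a \<omega> * real (card (h \<omega> \<inter> (C \<inter> b)))) \<in> borel_measurable L"
      using R C by (intro borel_measurable_times borel_measurable_indicator full)
        (auto intro: bounded_subset)
    ultimately show ?case by simp
  next
    case empty
    show ?case by simp
  next
    case (compl R)
    have "?f (?O - R) \<omega> = real (card (h \<omega> \<inter> C)) - ?f R \<omega>" if "\<omega> \<in> space L" for \<omega>
    proof -
      have eq: "{x \<in> h \<omega> \<inter> C. (\<omega>, x) \<in> ?O - R} = h \<omega> \<inter> C - {x \<in> h \<omega> \<inter> C. (\<omega>, x) \<in> R}"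
        using that by auto
      have sub: "{x \<in> h \<omega> \<inter> C. (\<omega>, x) \<in> R} \<subseteq> h \<omega> \<inter> C" by auto
      show ?thesis unfolding eq
        using card_Diff_subset[OF finite_subset[OF sub fin[OF that]] sub] card_mono[OF fin[OF that] sub]
        by (simp add: of_nat_diff)
    qed
    moreover have "(\<lambda>\<omega>. real (card (h \<omega> \<inter> C)) - ?f R \<omega>) \<in> borel_measurable L"
      using compl full[OF C] by (intro borel_measurable_diff)
    ultimately show ?case by (simp cong: measurable_cong)
  next
    case (union A)
    have "(\<lambda>n. \<Sum>i<n. ?f (A i) \<omega>) \<longlonglongrightarrow> ?f (\<Union>i. A i) \<omega>" if \<omega>: "\<omega> \<in> space L" for \<omega>
    proof -
      have card_eq: "?f R \<omega> = (\<Sum>x\<in>h \<omega> \<inter> C. indicator R (\<omega>, x))" for R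
        using fin[OF \<omega>] by (simp add: indicator_def sum.If_cases Int_def)
      have "(\<lambda>i. \<Sum>x\<in>h \<omega> \<inter> C. indicator (A i) (\<omega>, x)) sums
              (\<Sum>x\<in>h \<omega> \<inter> C. indicator (\<Union>i. A i) (\<omega>, x) :: real)"
        by (intro sums_sum indicator_sums) (use union(1) in \<open>auto simp: disjoint_family_on_def\<close>)
      then show ?thesis unfolding card_eq sums_def .
    qed
    then show ?case
      by (rule borel_measurable_LIMSEQ_real) (use union in \<open>auto intro!: borel_measurable_sum\<close>)
  qed
qed

lemma locally_finite_translate:
  assumes "locally_finite S"
  shows "locally_finite ((\<lambda>y. y - x) ` S)"
  unfolding locally_finite_def
proof (intro allI impI)
  fix K :: "'a set" assume "compact K"
  then have "finite (S \<inter> (\<lambda>y. x + y) ` K)"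
    using assms unfolding locally_finite_def by (simp add: compact_translation)
  moreover have "(\<lambda>y. y - x) ` S \<inter> K \<subseteq> (\<lambda>y. y - x) ` (S \<inter> (\<lambda>y. x + y) ` K)"
    by (force simp: image_iff)
  ultimately show "finite ((\<lambda>y. y - x) ` S \<inter> K)"
    by (meson finite_imageI finite_subset)
qed

lemma measurable_translate_configs:
  "(\<lambda>(S, x). (\<lambda>y. y - x) ` S) \<in> measurable (configs \<Otimes>\<^sub>M borel) (configs :: 'a::euclidean_space set measure)"
  (is "?T \<in> _")
proof -
  let ?L = "configs \<Otimes>\<^sub>M borel :: ('a set \<times> 'a) measure"
  have count: "(\<lambda>p. real (card (?T p \<inter> B))) \<in> borel_measurable ?L"
    if B: "B \<in> sets borel" "bounded B" for B :: "'a set"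
  proof (rule borel_measurable_LIMSEQ_real)
    let ?Q = "{q \<in> space (?L \<Otimes>\<^sub>M borel). snd q - snd (fst q) \<in> B}"
    let ?u = "\<lambda>m p. real (card {y \<in> fst p \<inter> cball 0 (real m). (p, y) \<in> ?Q})"
    show "?u m \<in> borel_measurable ?L" for m
    proof (rule measurable_card_section)
      have "(\<lambda>q. snd q - snd (fst q)) \<in> borel_measurable (?L \<Otimes>\<^sub>M borel)" by measurable
      from measurable_sets[OF this B(1)] show "?Q \<in> sets (?L \<Otimes>\<^sub>M borel)"
        by (simp add: vimage_def Int_def conj_commute)
    qed auto
    show "(\<lambda>m. ?u m p) \<longlonglongrightarrow> real (card (?T p \<inter> B))" if p: "p \<in> space ?L" for p
    proof -
      obtain S x where Sx: "p = (S, x)" by (cases p)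
      obtain c where c: "\<And>b. b \<in> B \<Longrightarrow> norm b \<le> c" using B(2) by (auto simp: bounded_iff)
      have "?u m p = real (card (?T p \<inter> B))" if "m \<ge> nat \<lceil>c + norm x\<rceil>" for m
      proof -
        have "c + norm x \<le> real m" using that by linarith
        then have far: "norm y \<le> real m" if "y - x \<in> B" for y
          using c[OF that] norm_triangle_sub[of y x] by linarith
        have "?T p \<inter> B = (\<lambda>y. y - x) ` {y \<in> fst p \<inter> cball 0 (real m). (p, y) \<in> ?Q}"
          using p far by (auto simp: Sx space_pair_measure)
        then show ?thesis by (simp add: card_image inj_on_def)
      qed
      then show ?thesis
        by (intro tendsto_eventually eventually_sequentiallyI)
    qed
  qed
  show ?thesis
  proof (rule measurable_sigma_sets[OF sets_configs])
    show "?T \<in> space ?L \<rightarrow> {S. locally_finite S}"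
      by (auto simp: space_pair_measure space_configs locally_finite_translate)
    fix A :: "'a set set"
    assume "A \<in> {{S. locally_finite S \<and> card (S \<inter> B) = n} | B n. B \<in> sets borel \<and> bounded B}"
    then obtain B n where A: "A = {S. locally_finite S \<and> card (S \<inter> B) = n}"
      and B: "B \<in> sets borel" "bounded B" by blast
    have "?T -` A \<inter> space ?L = (\<lambda>p. real (card (?T p \<inter> B))) -` {real n} \<inter> space ?L"
      by (auto simp: A space_pair_measure space_configs locally_finite_translate)
    also have "\<dots> \<in> sets ?L"
      by (rule measurable_sets[OF count[OF B]]) simp
    finally show "?T -` A \<inter> space ?L \<in> sets ?L" .
  qed auto
qed

definition point_process :: "'w measure \<Rightarrow> ('w \<Rightarrow> 'a::euclidean_space set) \<Rightarrow> bool" where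
  "point_process M X \<longleftrightarrow> prob_space M \<and> X \<in> measurable M configs"

abbreviation law :: "'w measure \<Rightarrow> ('w \<Rightarrow> 'a::euclidean_space set) \<Rightarrow> 'a set measure" where
  "law M X \<equiv> distr M configs X"

definition stationary :: "'w measure \<Rightarrow> ('w \<Rightarrow> 'a::euclidean_space set) \<Rightarrow> bool" where
  "stationary M X \<longleftrightarrow> (\<forall>t. law M (\<lambda>\<omega>. (\<lambda>y. y + t) ` X \<omega>) = law M X)"

text \<open>For a stationary process the mean number of points in a Borel set is proportional to its
  volume, so the intensity is the mean number of points in the unit cube.\<close>

definition intensity :: "'a::euclidean_space set measure \<Rightarrow> ennreal" where
  "intensity P = (\<integral>\<^sup>+ S. of_nat (card (S \<inter> cbox 0 One)) \<partial>P)"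

text \<open>Poisson process with some locally finite intensity measure \<open>\<Lambda>\<close>: Poisson distributed counts
  and independent counts in disjoint sets. The probabilities are written out because
  \<^const>\<open>poisson_pmf\<close> is unspecified at rate \<open>0\<close>, whereas \<open>\<Lambda> B = 0\<close> must be allowed here
  (the formula then gives the point mass at \<open>0\<close>).\<close>

definition poisson_process :: "'w measure \<Rightarrow> ('w \<Rightarrow> 'a::euclidean_space set) \<Rightarrow> bool" where
  "poisson_process M X \<longleftrightarrow>
     point_process M X \<and>
     (\<exists>\<Lambda>::'a measure. sets \<Lambda> = sets borel \<and> (\<forall>K. compact K \<longrightarrow> emeasure \<Lambda> K < \<infinity>) \<and>
        (\<forall>B k. B \<in> sets borel \<longrightarrow> bounded B \<longrightarrow>
           measure M {\<omega> \<in> space M. card (X \<omega> \<inter> B) = k}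
             = measure \<Lambda> B ^ k / fact k * exp (- measure \<Lambda> B))) \<and>
     (\<forall>(I::nat set) B. finite I \<longrightarrow> (\<forall>i\<in>I. B i \<in> sets borel \<and> bounded (B i)) \<longrightarrow>
        disjoint_family_on B I \<longrightarrow>
        prob_space.indep_vars M (\<lambda>_. count_space UNIV) (\<lambda>i \<omega>. card (X \<omega> \<inter> B i)) I)"

section \<open>Palm distributions\<close>

text \<open>The distribution \<open>P\<^sup>0\<close> seen from a typical point of a stationary process,
  \<open>P\<^sup>0(A) = \<lambda>\<^sup>-\<^sup>1 E (\<Sum>x \<in> X \<inter> C. 1{X - x \<in> A})\<close>. By stationarity the choice of the reference
  set of volume one, here the unit cube, is irrelevant.\<close>

definition palm :: "'a::euclidean_space set measure \<Rightarrow> 'a set measure" where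
  "palm P = measure_of (space configs) (sets configs)
     (\<lambda>A. (\<integral>\<^sup>+ S. of_nat (card {x \<in> S \<inter> cbox 0 One. (\<lambda>y. y - x) ` S \<in> A}) \<partial>P) / intensity P)"

lemma sets_palm: "sets (palm P) = sets configs"
  unfolding palm_def by (simp add: sets.sets_measure_of_eq)

text \<open>The set function used in the definition of \<^const>\<open>palm\<close> is countably additive, hence it is
  what \<^const>\<open>emeasure\<close> returns.\<close>

lemma emeasure_palm:
  fixes P :: "'a::euclidean_space set measure"
  assumes P: "sets P = sets configs" and A: "A \<in> sets configs"
  shows "emeasure (palm P) A =
    (\<integral>\<^sup>+ S. of_nat (card {x \<in> S \<inter> cbox 0 One. (\<lambda>y. y - x) ` S \<in> A}) \<partial>P) / intensity P"
proof -
  let ?n = "\<lambda>A S. card {x \<in> S \<inter> cbox 0 One. (\<lambda>y. y - x) ` S \<in> A}"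
  let ?\<mu> = "\<lambda>A. (\<integral>\<^sup>+ S. of_nat (?n A S) \<partial>P) / intensity P"
  have space: "space P = {S. locally_finite S}"
    using sets_eq_imp_space_eq[OF P] by (simp add: space_configs)
  have meas: "(\<lambda>S. of_nat (?n A S) :: ennreal) \<in> borel_measurable P" if "A \<in> sets configs" for A
  proof -
    let ?Q = "{p \<in> space (configs \<Otimes>\<^sub>M borel). (\<lambda>(S, x). (\<lambda>y. y - x) ` S) p \<in> A}"
    have Q: "?Q \<in> sets (configs \<Otimes>\<^sub>M (borel :: 'a measure))"
      using measurable_sets[OF measurable_translate_configs that] by (simp add: vimage_def Int_def conj_commute)
    have "(\<lambda>S. real (card {x \<in> S \<inter> cbox 0 One. (S, x) \<in> ?Q})) \<in> borel_measurable configs"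
      by (rule measurable_card_section[where h = "\<lambda>S. S"]) (use Q in auto)
    then have "(\<lambda>S. real (?n A S)) \<in> borel_measurable configs"
      by (rule measurable_cong[THEN iffD1, rotated]) (simp add: space_pair_measure)
    then have "(\<lambda>S. ennreal (real (?n A S))) \<in> borel_measurable P"
      using measurable_cong_sets[OF P refl] by auto
    then show ?thesis by (simp add: ennreal_of_nat_eq_real_of_nat)
  qed
  show ?thesis
    unfolding palm_def
  proof (rule emeasure_measure_of_sigma[where \<mu> = ?\<mu>])
    show "sigma_algebra (space (configs :: 'a set measure)) (sets configs)" ..
    show "positive (sets configs) ?\<mu>" by (simp add: positive_def)
    show "countably_additive (sets configs) ?\<mu>"
    proof (rule countably_additiveI)
      fix F :: "nat \<Rightarrow> 'a set set"
      assume F: "range F \<subseteq> sets configs" "disjoint_family F"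
      have "(\<Sum>i. of_nat (?n (F i) S)) = (of_nat (?n (\<Union>i. F i) S) :: ennreal)"
        if "S \<in> space P" for S
      proof -
        have fin: "finite (S \<inter> cbox 0 One)"
          using that by (simp add: space locally_finite_bounded)
        have eq: "of_nat (?n A S) = (\<Sum>x\<in>S \<inter> cbox 0 One. indicator A ((\<lambda>y. y - x) ` S) :: ennreal)" for A
          using fin by (simp add: indicator_def sum.If_cases Int_def)
        show ?thesis unfolding eq
          by (subst suminf_sum) (simp_all add: suminf_indicator[OF F(2)])
      qed
      then have "(\<integral>\<^sup>+ S. of_nat (?n (\<Union>i. F i) S) \<partial>P) = (\<integral>\<^sup>+ S. (\<Sum>i. of_nat (?n (F i) S)) \<partial>P)"
        by (intro nn_integral_cong) simp
      also have "\<dots> = (\<Sum>i. \<integral>\<^sup>+ S. of_nat (?n (F i) S) \<partial>P)"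
        using F by (intro nn_integral_suminf meas) auto
      finally show "(\<Sum>i. ?\<mu> (F i)) = ?\<mu> (\<Union>i. F i)"
        by (simp add: divide_ennreal_def)
    qed
    show "A \<in> sets configs" by (rule A)
  qed
qed

lemma prob_space_palm:
  fixes P :: "'a::euclidean_space set measure"
  assumes P: "sets P = sets configs" and "0 < intensity P" "intensity P < \<infinity>"
  shows "prob_space (palm P)"
proof (rule prob_spaceI)
  have sp: "space (palm P) = space (configs :: 'a set measure)"
    by (rule sets_eq_imp_space_eq[OF sets_palm])
  have "emeasure (palm P) (space configs) =
    (\<integral>\<^sup>+ S. of_nat (card {x \<in> S \<inter> cbox 0 One. (\<lambda>y. y - x) ` S \<in> space configs}) \<partial>P) / intensity P"
    by (rule emeasure_palm[OF P sets.top])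
  also have "(\<integral>\<^sup>+ S. of_nat (card {x \<in> S \<inter> cbox 0 One. (\<lambda>y. y - x) ` S \<in> space configs}) \<partial>P) = intensity P"
    unfolding intensity_def
    by (intro nn_integral_cong)
      (simp add: sets_eq_imp_space_eq[OF P] space_configs locally_finite_translate Int_def)
  finally show "emeasure (palm P) (space (palm P)) = 1"
    using assms by (simp add: sp ennreal_divide_self)
qed

definition reduced_palm :: "'a::euclidean_space set measure \<Rightarrow> 'a set measure" where
  "reduced_palm P = distr (palm P) configs (\<lambda>S. S - {0})"

section \<open>The window based J function\<close>

definition hit_F :: "'a::euclidean_space set measure \<Rightarrow> 'a set \<Rightarrow> real" where
  "hit_F P K = measure P {S \<in> space P. S \<inter> K \<noteq> {}}"

definition hit_G :: "'a::euclidean_space set measure \<Rightarrow> 'a set \<Rightarrow> real" where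
  "hit_G P K = measure (reduced_palm P) {S \<in> space (reduced_palm P). S \<inter> K \<noteq> {}}"

definition J_window :: "'a::euclidean_space set measure \<Rightarrow> 'a set \<Rightarrow> real \<Rightarrow> real" where
  "J_window P W r =
     (LINT x:W|lborel. 1 - hit_G P (cball 0 r \<inter> (\<lambda>y. y - x) ` W)) /
     (LINT x:W|lborel. 1 - hit_F P (cball 0 r \<inter> (\<lambda>y. y - x) ` W))"

end

theory Submission
  imports Defs
begin

text \<open>Write \<open>\<Lambda>\<close> for the intensity measure of the Poisson process and \<open>C\<close> for the unit cube. The \<open>J\<close>
  function compares probabilities of avoiding the compact sets \<open>K = B(0,r) \<inter> (W - x)\<close> under the
  law of \<open>X\<close> and under the reduced Palm law. By Slivnyak's theorem these laws agree for a stationary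
  Poisson process; what is needed here is that both avoid a compact \<open>K\<close> with probability
  \<open>exp (- \<Lambda> K)\<close>. For the law of \<open>X\<close> this is the Poisson distribution of the count in \<open>K\<close>. For the
  reduced Palm law (\<open>palm_prob_void\<close>) it is proved by an elementary discretisation.

  By definition the Palm probability is, up to the factor \<open>\<Lambda> C\<close>, the mean number of points
  \<open>x \<in> X \<inter> C\<close> such that \<open>x + K\<close> contains no point of \<open>X\<close> except possibly \<open>x\<close>. A set has no
  multiple points, so \<open>\<Lambda>\<close> has no atoms, and \<open>C\<close> splits into finitely many Borel cells \<open>U\<close> of small
  diameter and small mass (\<open>fine_partition\<close>). If \<open>c\<close> is a centre of \<open>U\<close>, the condition on a point
  \<open>x \<in> U\<close> can be compared with avoiding \<open>(c + K) - U\<close>, which is independent of the count in \<open>U\<close>.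
  The error made by moving \<open>x\<close> to \<open>c\<close> is absorbed by a thickening \<open>K\<^sub>e = {z. infdist z K \<le> e}\<close>. Summing
  over the cells and using translation invariance of \<open>\<Lambda>\<close> yields
  \<open>palm (avoid K\<^sub>e) \<le> exp (d - \<Lambda> K)\<close> and \<open>palm (avoid K) \<ge> exp (- d - \<Lambda> K\<^sub>e)\<close>
  for all positive \<open>d\<close> and \<open>e\<close> (\<open>nn_integral_isolated_le\<close>, \<open>nn_integral_isolated_ge\<close>).

  Both bounds close up as \<open>d\<close> and \<open>e\<close> tend to \<open>0\<close>. In the lower bound, \<open>K\<^sub>e\<close> decreases to \<open>K\<close>, so
  \<open>\<Lambda> K\<^sub>e\<close> tends to \<open>\<Lambda> K\<close>. In the upper bound, a locally finite set that avoids the compact set \<open>K\<close>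
  also avoids some \<open>K\<^sub>e\<close>, so the events of avoiding \<open>K\<^sub>e\<close> increase to the event of avoiding \<open>K\<close>.
  Thickening from outside on both sides matters: an inner approximation could fail, since \<open>K\<close> may
  have positive volume and empty interior.

  Hence numerator and denominator of \<open>J\<close> are the same integral. It remains to see that it is
  not zero: its integrand is measurable and bounded below on \<open>W\<close> by \<open>exp (- \<Lambda> (B(0,r))) > 0\<close>, and
  \<open>W\<close> has positive volume.\<close>

section \<open>Events and maps on configurations\<close>

lemma sets_counts_configs:
  assumes "B \<in> sets borel" "bounded B"
  shows "{S \<in> space configs. card (S \<inter> B) = k} \<in> sets configs"
proof -
  have "(\<lambda>S. card (S \<inter> B)) -` {k} \<inter> space configs \<in> sets configs"
    by (rule measurable_sets[OF measurable_card_configs[OF assms]]) simp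
  then show ?thesis by (simp add: vimage_def Int_def conj_commute)
qed

lemma card_Int_eq_0_iff:
  assumes "S \<in> space configs" "bounded B"
  shows "card (S \<inter> B) = 0 \<longleftrightarrow> S \<inter> B = {}"
  using locally_finite_bounded[of S B] assms by (simp add: space_configs)

lemma sets_void_configs:
  assumes "B \<in> sets borel" "bounded B"
  shows "{S \<in> space configs. S \<inter> B = {}} \<in> sets configs"
proof -
  have "{S \<in> space configs. S \<inter> B = {}} = {S \<in> space configs. card (S \<inter> B) = 0}"
    using card_Int_eq_0_iff[OF _ assms(2)] by auto
  then show ?thesis using sets_counts_configs[OF assms] by simp
qed

text \<open>Deleting \<open>a\<close> turns the count in \<open>B\<close> into the count in \<open>B - {a}\<close>, so generators pull back to
  generators.\<close>

lemma measurable_remove_point: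
  "(\<lambda>S. S - {a}) \<in> measurable configs (configs :: 'a::euclidean_space set measure)"
proof (rule measurable_sigma_sets[OF sets_configs])
  show map: "(\<lambda>S. S - {a}) \<in> space configs \<rightarrow> {S. locally_finite S}"
    by (auto simp: space_configs locally_finite_def Diff_Int_distrib2)
  fix A :: "'a set set"
  assume "A \<in> {{S. locally_finite S \<and> card (S \<inter> B) = n} | B n. B \<in> sets borel \<and> bounded B}"
  then obtain B n where A: "A = {S. locally_finite S \<and> card (S \<inter> B) = n}"
    and B: "B \<in> sets borel" "bounded B" by blast
  have remove: "(S - {a}) \<inter> B = S \<inter> (B - {a})" for S by auto
  have "(\<lambda>S. S - {a}) -` A \<inter> space configs = {S \<in> space configs. card (S \<inter> (B - {a})) = n}"
    using map by (auto simp: A remove)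
  also have "\<dots> \<in> sets configs"
    using B by (intro sets_counts_configs) (auto intro: bounded_subset)
  finally show "(\<lambda>S. S - {a}) -` A \<inter> space configs \<in> sets configs" .
qed auto

lemma poisson_mean_sums:
  fixes v :: real
  shows "(\<lambda>k. real k * (v ^ k / fact k * exp (- v))) sums v"
proof -
  have "(\<lambda>k. v ^ k / fact k) sums exp v"
    using exp_converges[of v] by (simp add: divide_inverse mult.commute)
  then have "(\<lambda>k. (v ^ k / fact k) * (v * exp (- v))) sums (exp v * (v * exp (- v)))"
    by (rule sums_mult2)
  moreover have "exp v * (v * exp (- v)) = v"
    using exp_minus_inverse[of v] by (simp add: mult.left_commute)
  moreover have "(v ^ k / fact k) * (v * exp (- v)) = real (Suc k) * (v ^ Suc k / fact (Suc k) * exp (- v))"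
    for k by (simp add: field_simps del: of_nat_Suc)
  ultimately have "(\<lambda>k. real (Suc k) * (v ^ Suc k / fact (Suc k) * exp (- v))) sums v"
    by (simp only:)
  then show ?thesis
    by (subst (asm) sums_Suc_iff) simp
qed

lemma sets_translate:
  fixes t :: "'a::euclidean_space"
  assumes "B \<in> sets borel"
  shows "{y. y - t \<in> B} \<in> sets borel"
proof -
  have "(\<lambda>y. y - t) \<in> borel_measurable borel" by measurable
  from measurable_sets[OF this assms] show ?thesis by (simp add: vimage_def)
qed

lemma bounded_translate:
  fixes t :: "'a::euclidean_space"
  assumes "bounded B"
  shows "bounded {y. y - t \<in> B}"
proof -
  have "{y. y - t \<in> B} = (+) t ` B" by (force simp: image_iff)
  then show ?thesis using bounded_translation[OF assms] by simp
qed

section \<open>Thickenings of a compact set\<close>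

abbreviation thicken :: "real \<Rightarrow> 'a::euclidean_space set \<Rightarrow> 'a set" where
  "thicken e K \<equiv> {z. infdist z K \<le> e}"

text \<open>If \<open>a\<close> and \<open>b\<close> are within distance \<open>e\<close>, then \<open>b + z \<in> a + K\<close> forces \<open>z\<close> into the thickening of \<open>K\<close>.
  This lets the centre of a small cell stand in for every point of the cell.\<close>

lemma thicken_shift:
  assumes "k \<in> K" "dist a b \<le> e"
  shows "a - b + k \<in> thicken e K"
  using infdist_le[OF assms(1), of "a - b + k"] assms(2) by (simp add: dist_norm)

lemma INT_thicken:
  assumes "compact K" "K \<noteq> {}"
  shows "(\<Inter>n. thicken (1 / real (Suc n)) K) = K"
proof
  show "(\<Inter>n. thicken (1 / real (Suc n)) K) \<subseteq> K"
  proof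
    fix z assume z: "z \<in> (\<Inter>n. thicken (1 / real (Suc n)) K)"
    have "infdist z K = 0"
    proof (rule ccontr)
      assume "infdist z K \<noteq> 0"
      then have "0 < infdist z K" using infdist_nonneg[of z K] by linarith
      then obtain n where "1 / real (Suc n) < infdist z K" by (rule nat_approx_posE)
      with z show False by (auto simp: not_le[symmetric])
    qed
    then show "z \<in> K" using assms in_closed_iff_infdist_zero[of K z] compact_imp_closed by auto
  qed
qed auto

lemma decseq_thicken: "decseq (\<lambda>n. thicken (1 / real (Suc n)) K)"
proof -
  have "1 / real (Suc n) \<le> 1 / real (Suc m)" if "m \<le> n" for m n
    using that by (intro divide_left_mono) auto
  then show ?thesis by (force simp: decseq_def simp del: of_nat_Suc intro: order_trans)
qed

section \<open>Isolated points and counts over partitions\<close>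

text \<open>The points \<open>x\<close> of \<open>S\<close> for which the reduced configuration \<open>(S - x) - {0}\<close> avoids \<open>K\<close>. Their mean
  number in the unit cube is, up to the intensity, the reduced Palm probability of avoiding \<open>K\<close>.\<close>

definition isolated :: "'a::euclidean_space set \<Rightarrow> 'a set \<Rightarrow> 'a set" where
  "isolated K S = {x \<in> S. \<forall>y\<in>S. y - x \<in> K \<longrightarrow> y = x}"

lemma card_partition:
  assumes "disjoint_family U" "finite (S \<inter> (\<Union>i<n. U i))" "T \<subseteq> S"
  shows "card (T \<inter> (\<Union>i<(n::nat). U i)) = (\<Sum>i<n. card (T \<inter> U i))"
proof -
  have "T \<inter> (\<Union>i<n. U i) = (\<Union>i<n. T \<inter> U i)" by auto
  also have "card \<dots> = (\<Sum>i<n. card (T \<inter> U i))"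
    using assms by (intro card_UN_disjoint) (auto simp: disjoint_family_on_def intro: finite_subset[rotated])
  finally show ?thesis .
qed

section \<open>Void probabilities and counts of a stationary Poisson law\<close>

text \<open>The consequences of being stationary and Poisson that the comparison uses, stated for the law on
  configurations. Independence enters only for the count in one set and the void event of
  a disjoint one, and stationarity only through void events, which already determine \<open>\<Lambda>\<close>.\<close>

locale stationary_poisson_law = prob_space P
  for P :: "'a::euclidean_space set measure" +
  fixes \<Lambda> :: "'a measure"
  assumes sets_P: "sets P = sets configs"
    and sets_\<Lambda>: "sets \<Lambda> = sets borel"
    and compact_finite: "compact K \<Longrightarrow> emeasure \<Lambda> K < \<infinity>"
    and prob_count: "B \<in> sets borel \<Longrightarrow> bounded B \<Longrightarrow>
      prob {S \<in> space P. card (S \<inter> B) = k} = measure \<Lambda> B ^ k / fact k * exp (- measure \<Lambda> B)"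
    and prob_count_void: "U \<in> sets borel \<Longrightarrow> bounded U \<Longrightarrow> V \<in> sets borel \<Longrightarrow> bounded V \<Longrightarrow>
      U \<inter> V = {} \<Longrightarrow> prob {S \<in> space P. card (S \<inter> U) = k \<and> S \<inter> V = {}} =
        prob {S \<in> space P. card (S \<inter> U) = k} * prob {S \<in> space P. S \<inter> V = {}}"
    and prob_void_translate: "B \<in> sets borel \<Longrightarrow> bounded B \<Longrightarrow>
      prob {S \<in> space P. S \<inter> {y. y - t \<in> B} = {}} = prob {S \<in> space P. S \<inter> B = {}}"
begin

abbreviation "vol \<equiv> measure \<Lambda>"

lemma space_P: "space P = space configs"
  by (rule sets_eq_imp_space_eq[OF sets_P])

lemma space_\<Lambda>: "space \<Lambda> = UNIV"
  using sets_eq_imp_space_eq[OF sets_\<Lambda>] by simp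

lemma finite_Int: "S \<in> space P \<Longrightarrow> bounded B \<Longrightarrow> finite (S \<inter> B)"
  by (simp add: space_P space_configs locally_finite_bounded)

lemma fmeasurable_bounded:
  assumes "B \<in> sets borel" "bounded B"
  shows "B \<in> fmeasurable \<Lambda>"
proof (rule fmeasurableI)
  have "emeasure \<Lambda> B \<le> emeasure \<Lambda> (closure B)"
    by (rule emeasure_mono[OF closure_subset]) (simp add: sets_\<Lambda>)
  also have "\<dots> < \<infinity>" using assms by (intro compact_finite) (simp add: compact_closure)
  finally show "emeasure \<Lambda> B < \<infinity>" .
qed (use assms sets_\<Lambda> in auto)

lemma prob_void:
  assumes "B \<in> sets borel" "bounded B"
  shows "prob {S \<in> space P. S \<inter> B = {}} = exp (- vol B)"
proof -
  have "{S \<in> space P. S \<inter> B = {}} = {S \<in> space P. card (S \<inter> B) = 0}"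
    using card_Int_eq_0_iff[OF _ assms(2)] by (auto simp: space_P)
  then show ?thesis using prob_count[OF assms, of 0] by simp
qed

lemma vol_translate:
  assumes "B \<in> sets borel" "bounded B"
  shows "vol {y. y - t \<in> B} = vol B"
  using prob_void_translate[OF assms, of t] prob_void[OF assms]
    prob_void[OF sets_translate bounded_translate, OF assms, of t] by simp

text \<open>A count in \<open>{x}\<close> is never \<open>2\<close>, whereas a Poisson count of positive mean is \<open>2\<close> with positive
  probability.\<close>

lemma vol_singleton: "vol {x} = 0"
proof -
  have "card (S \<inter> {x}) \<le> 1" for S :: "'a set"
    by (rule order_trans[OF card_mono[of "{x}"]]) auto
  then have "card (S \<inter> {x}) \<noteq> 2" for S :: "'a set"
    by (metis numeral_le_one_iff semiring_norm(69))
  then have "prob {S \<in> space P. card (S \<inter> {x}) = 2} = 0" by simp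
  then show ?thesis using prob_count[of "{x}" 2] by simp
qed

lemma events_count: "B \<in> sets borel \<Longrightarrow> bounded B \<Longrightarrow> {S \<in> space P. card (S \<inter> B) = k} \<in> events"
  using sets_counts_configs by (simp add: sets_P space_P)

lemma events_void: "B \<in> sets borel \<Longrightarrow> bounded B \<Longrightarrow> {S \<in> space P. S \<inter> B = {}} \<in> events"
  using sets_void_configs by (simp add: sets_P space_P)

lemma events_count_void:
  assumes "U \<in> sets borel" "bounded U" "V \<in> sets borel" "bounded V"
  shows "{S \<in> space P. card (S \<inter> U) = k \<and> S \<inter> V = {}} \<in> events"
proof -
  have "{S \<in> space P. card (S \<inter> U) = k \<and> S \<inter> V = {}} =
      {S \<in> space P. card (S \<inter> U) = k} \<inter> {S \<in> space P. S \<inter> V = {}}" by auto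
  then show ?thesis using events_count events_void assms by auto
qed

text \<open>The expectation factorises by independence, and a Poisson count has mean \<open>vol U\<close>. Taking \<open>V = {}\<close>
  gives the intensity.\<close>

lemma nn_integral_count_void:
  assumes U: "U \<in> sets borel" "bounded U" and V: "V \<in> sets borel" "bounded V" and "U \<inter> V = {}"
  shows "(\<integral>\<^sup>+ S. of_nat (card (S \<inter> U)) * indicator {S \<in> space P. S \<inter> V = {}} S \<partial>P) =
    ennreal (vol U * exp (- vol V))"
proof -
  let ?E = "\<lambda>k. {S \<in> space P. card (S \<inter> U) = k \<and> S \<inter> V = {}}"
  have E: "?E k \<in> events" for k by (rule events_count_void[OF U V])
  \<comment> \<open>Split according to the value of the count; only one summand is non-zero at each \<open>S\<close>.\<close>
  have pointwise: "of_nat (card (S \<inter> U)) * indicator {S \<in> space P. S \<inter> V = {}} S =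
      (\<Sum>k. of_nat k * indicator (?E k) S :: ennreal)" if "S \<in> space P" for S
  proof -
    define g where "g k = (of_nat k * indicator (?E k) S :: ennreal)" for k
    have "g sums (\<Sum>k\<in>{card (S \<inter> U)}. g k)"
      by (rule sums_finite) (auto simp: g_def indicator_def)
    then have "(\<Sum>k. g k) = g (card (S \<inter> U))" by (simp add: sums_iff)
    then show ?thesis by (simp add: g_def indicator_def)
  qed
  have "(\<integral>\<^sup>+ S. of_nat (card (S \<inter> U)) * indicator {S \<in> space P. S \<inter> V = {}} S \<partial>P) =
      (\<integral>\<^sup>+ S. (\<Sum>k. of_nat k * indicator (?E k) S) \<partial>P)"
    by (rule nn_integral_cong) (rule pointwise)
  also have "\<dots> = (\<Sum>k. \<integral>\<^sup>+ S. of_nat k * indicator (?E k) S \<partial>P)"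
    using E by (intro nn_integral_suminf) auto
  also have "\<dots> = (\<Sum>k. ennreal (real k * (vol U ^ k / fact k * exp (- vol U)) * exp (- vol V)))"
    by (simp add: nn_integral_cmult_indicator[OF E] emeasure_eq_measure prob_count_void[OF assms]
        prob_count[OF U] prob_void[OF V] ennreal_of_nat_eq_real_of_nat ennreal_mult'[symmetric] mult.assoc)
  also have "\<dots> = ennreal (vol U * exp (- vol V))"
    by (intro suminf_ennreal_eq sums_mult2 poisson_mean_sums) auto
  finally show ?thesis .
qed

abbreviation "cube \<equiv> cbox 0 (One :: 'a)"

lemma intensity_eq_vol: "intensity P = ennreal (vol cube)"
proof -
  have "intensity P = (\<integral>\<^sup>+ S. of_nat (card (S \<inter> cube)) * indicator {S \<in> space P. S \<inter> {} = {}} S \<partial>P)"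
    unfolding intensity_def by (intro nn_integral_cong) simp
  also have "\<dots> = ennreal (vol cube * exp (- vol {}))"
    by (rule nn_integral_count_void) auto
  finally show ?thesis by simp
qed

section \<open>Two-sided bounds by discretisation\<close>

text \<open>Since \<open>\<Lambda>\<close> has no atoms, every point is the centre of a ball of radius at most \<open>e\<close> and mass at most
  \<open>d\<close>. Finitely many of these cover \<open>C\<close>, and the cells are the balls made disjoint.\<close>

lemma fine_partition:
  assumes "compact C" "0 < e" "0 < d"
  obtains n :: nat and U :: "nat \<Rightarrow> 'a set" and c :: "nat \<Rightarrow> 'a"
  where "\<And>i. U i \<in> sets borel" "\<And>i. bounded (U i)" "disjoint_family U" "(\<Union>i<n. U i) = C"
    "\<And>i. U i \<subseteq> cball (c i) e" "\<And>i. i < n \<Longrightarrow> vol (U i) \<le> d"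
proof -
  have "\<exists>s>0. s \<le> e \<and> vol (cball x s) \<le> d" for x
  proof -
    let ?B = "\<lambda>n. cball x (1 / real (Suc n))"
    have dec: "decseq ?B"
      by (auto simp: decseq_def divide_simps intro!: subset_cball)
    have "(\<Inter>n. ?B n) = {x}"
    proof -
      have "y = x" if "\<forall>n. dist x y \<le> 1 / real (Suc n)" for y
        using that nat_approx_posE[of "dist x y"] by (metis dist_pos_lt not_less)
      then show ?thesis by auto
    qed
    moreover have "(\<lambda>n. vol (?B n)) \<longlonglongrightarrow> vol (\<Inter>n. ?B n)"
      using dec compact_finite by (intro Lim_measure_decseq) (auto simp: sets_\<Lambda> less_top[symmetric] intro!: less_imp_neq)
    ultimately have "(\<lambda>n. vol (?B n)) \<longlonglongrightarrow> 0" by (simp add: vol_singleton)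
    then have "\<forall>\<^sub>F n in sequentially. vol (?B n) < d"
      using assms by (intro order_tendstoD)
    moreover have "\<forall>\<^sub>F n in sequentially. 1 / real (Suc n) < e"
      using order_tendstoD(2)[OF LIMSEQ_inverse_real_of_nat assms(2)] by (simp add: inverse_eq_divide)
    ultimately have "\<forall>\<^sub>F n in sequentially. vol (?B n) < d \<and> 1 / real (Suc n) < e"
      by eventually_elim auto
    then obtain n where "vol (?B n) < d" "1 / real (Suc n) < e"
      using eventually_happens'[OF sequentially_bot] by blast
    then show ?thesis by (intro exI[of _ "1 / real (Suc n)"]) auto
  qed
  then obtain s where s: "\<And>x. 0 < s x" "\<And>x. s x \<le> e" "\<And>x. vol (cball x (s x)) \<le> d"
    by metis
  obtain D where D: "D \<subseteq> C" "finite D" "C \<subseteq> (\<Union>x\<in>D. ball x (s x))"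
    by (rule compactE_image[OF assms(1), of C "\<lambda>x. ball x (s x)"]) (use s in force)+
  obtain n :: nat and c where c: "D = c ` {..<n}"
    using finite_imp_nat_seg_image_inj_on[OF D(2)] by (auto simp: lessThan_def)
  define A where "A i = (if i < n then C \<inter> ball (c i) (s (c i)) else {})" for i
  have Ab: "A i \<in> sets borel" "bounded (A i)" for i
    using assms(1) by (auto simp: A_def borel_compact intro: bounded_subset[OF bounded_ball])
  have sub: "disjointed A i \<subseteq> A i" for i by (rule disjointed_subset)
  show ?thesis
  proof (rule that)
    show U: "disjointed A i \<in> sets borel" for i
      using sets.range_disjointed_sets[of A borel] Ab by auto
    show "bounded (disjointed A i)" for i by (rule bounded_subset[OF Ab(2) sub])
    show "disjoint_family (disjointed A)" by (rule disjoint_family_disjointed)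
    have "(\<Union>i<n. disjointed A i) = (\<Union>i. disjointed A i)"
      using sub by (force simp: A_def split: if_splits)
    also have "\<dots> = (\<Union>i. A i)" by (rule UN_disjointed_eq)
    also have "\<dots> = C" using D(3) by (auto simp: c A_def split: if_splits)
    finally show "(\<Union>i<n. disjointed A i) = C" .
    have ball: "A i \<subseteq> cball (c i) (s (c i))" for i by (auto simp: A_def split: if_splits)
    show "disjointed A i \<subseteq> cball (c i) e" for i
      using sub[of i] ball[of i] subset_cball[OF s(2)[of "c i"]] by blast
    show "vol (disjointed A i) \<le> d" if "i < n" for i
    proof -
      have "vol (disjointed A i) \<le> vol (cball (c i) (s (c i)))"
        using sub ball by (intro measure_mono_fmeasurable fmeasurable_bounded)
          (auto simp: sets_\<Lambda> U)
      then show ?thesis using s(3)[of "c i"] by linarith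
    qed
  qed
qed

lemma vol_partition:
  assumes "disjoint_family U" "\<And>i. U i \<in> sets borel" "\<And>i. bounded (U i)"
  shows "vol (\<Union>i<(n::nat). U i) = (\<Sum>i<n. vol (U i))"
  using assms fmeasurable_bounded
  by (intro measure_UNION') (auto simp: disjoint_family_on_def pairwise_def disjnt_def)

text \<open>A cell \<open>U\<close> with centre \<open>c\<close> contains a point that is isolated with respect to the thickening of \<open>K\<close>
  only if no point lies in \<open>V = (c + K) - U\<close>, and then it contributes at most the count in \<open>U\<close>.
  As \<open>U\<close> and \<open>V\<close> are disjoint, the mean contribution is at most \<open>vol U * exp (- vol V)\<close>, and removing
  \<open>U\<close> costs at most \<open>d\<close> in the exponent.\<close>

lemma nn_integral_isolated_le:
  assumes K: "compact K" and "0 < e" "0 < d"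
  shows "(\<integral>\<^sup>+ S. of_nat (card (isolated (thicken e K) S \<inter> cube)) \<partial>P) \<le> ennreal (vol cube * exp (d - vol K))"
proof -
  obtain n :: nat and U c where U: "\<And>i. U i \<in> sets borel" "\<And>i. bounded (U i)" "disjoint_family U"
      "(\<Union>i<n. U i) = cube" "\<And>i. U i \<subseteq> cball (c i) e" "\<And>i. i < n \<Longrightarrow> vol (U i) \<le> d"
    using fine_partition[OF compact_cbox assms(2,3)] by metis
  define V where "V i = {y. y - c i \<in> K} - U i" for i
  have KB: "K \<in> sets borel" "bounded K" using K by (auto simp: borel_compact compact_imp_bounded)
  have tr: "{y. y - c i \<in> K} \<in> sets borel" "bounded {y. y - c i \<in> K}" for i
    by (rule sets_translate[OF KB(1)], rule bounded_translate[OF KB(2)])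
  have V: "V i \<in> sets borel" "bounded (V i)" "U i \<inter> V i = {}" for i
    using tr(1)[of i] bounded_subset[OF tr(2)[of i], of "V i"] U(1) by (auto simp: V_def)
  have volV: "vol K - d \<le> vol (V i)" if "i < n" for i
  proof -
    have "vol {y. y - c i \<in> K} \<le> vol (V i \<union> U i)"
      using V U(1,2) tr
      by (intro measure_mono_fmeasurable fmeasurable_bounded) (auto simp: V_def sets_\<Lambda>)
    also have "\<dots> \<le> vol (V i) + vol (U i)"
      using V U(1) by (intro measure_Un_le) (auto simp: sets_\<Lambda>)
    finally show ?thesis using U(6)[OF that] vol_translate[OF KB] by simp
  qed
  let ?f = "\<lambda>i S. of_nat (card (S \<inter> U i)) * indicator {S \<in> space P. S \<inter> V i = {}} S :: ennreal"
  have cell: "of_nat (card (isolated (thicken e K) S \<inter> U i)) \<le> ?f i S"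
    if S: "S \<in> space P" for S i
  proof (cases "isolated (thicken e K) S \<inter> U i = {}")
    case False
    then obtain x where x: "x \<in> S" "x \<in> U i" "\<And>y. y \<in> S \<Longrightarrow> y - x \<in> thicken e K \<Longrightarrow> y = x"
      by (auto simp: isolated_def)
    have "False" if z: "z \<in> S" "z - c i \<in> K" "z \<notin> U i" for z
    proof -
      have "c i - x + (z - c i) \<in> thicken e K"
        using U(5)[of i] x(2) by (intro thicken_shift z) auto
      then have "z = x" using x(3)[OF z(1)] by simp
      with x z show False by simp
    qed
    then have "S \<inter> V i = {}" by (auto simp: V_def)
    moreover have "card (isolated (thicken e K) S \<inter> U i) \<le> card (S \<inter> U i)"
      using finite_Int[OF S U(2)] by (intro card_mono) (auto simp: isolated_def)
    ultimately show ?thesis using S by (simp add: indicator_def)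
  qed simp
  have meas: "?f i \<in> borel_measurable P" for i
  proof -
    have "(\<lambda>S. card (S \<inter> U i)) \<in> measurable P (count_space UNIV)"
      using measurable_card_configs[OF U(1,2)] measurable_cong_sets[OF sets_P refl] by blast
    then have "(\<lambda>S. of_nat (card (S \<inter> U i)) :: ennreal) \<in> borel_measurable P"
      by (rule measurable_compose) simp
    then show ?thesis using events_void[OF V(1,2)] by (intro borel_measurable_times_ennreal borel_measurable_indicator)
  qed
  have "(\<integral>\<^sup>+ S. of_nat (card (isolated (thicken e K) S \<inter> cube)) \<partial>P) \<le> (\<integral>\<^sup>+ S. (\<Sum>i<n. ?f i S) \<partial>P)"
  proof (rule nn_integral_mono)
    fix S assume S: "S \<in> space P"
    have "card (isolated (thicken e K) S \<inter> cube) = (\<Sum>i<n. card (isolated (thicken e K) S \<inter> U i))"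
      unfolding U(4)[symmetric]
      by (rule card_partition[OF U(3), where S = S]) (use finite_Int[OF S, of cube] in \<open>auto simp: U(4) isolated_def\<close>)
    then show "of_nat (card (isolated (thicken e K) S \<inter> cube)) \<le> (\<Sum>i<n. ?f i S)"
      by (simp only: of_nat_sum) (intro sum_mono cell[OF S])
  qed
  also have "\<dots> = (\<Sum>i<n. ennreal (vol (U i) * exp (- vol (V i))))"
    by (simp only: nn_integral_sum[OF meas] nn_integral_count_void[OF U(1,2) V])
  also have "\<dots> \<le> (\<Sum>i<n. ennreal (vol (U i) * exp (d - vol K)))"
    using volV by (intro sum_mono ennreal_leI mult_left_mono) (auto simp: algebra_simps)
  also have "\<dots> = ennreal (vol cube * exp (d - vol K))"
    by (simp add: sum_distrib_right[symmetric] vol_partition[OF U(3,1,2), symmetric] U(4))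
  finally show ?thesis .
qed

text \<open>Conversely, if a cell \<open>U\<close> contains exactly one point and \<open>V\<close>, the translate of the thickening to
  the centre with \<open>U\<close> removed, contains none, then the point in \<open>U\<close> is isolated with respect
  to \<open>K\<close>. The probability of this is \<open>vol U * exp (- vol U) * exp (- vol V)\<close>, and \<open>vol U \<le> d\<close>.\<close>

lemma nn_integral_isolated_ge:
  assumes K: "compact K" "K \<noteq> {}" and "0 < e" "0 < d"
  shows "ennreal (vol cube * exp (- d - vol (thicken e K))) \<le> (\<integral>\<^sup>+ S. of_nat (card (isolated K S \<inter> cube)) \<partial>P)"
proof -
  obtain n :: nat and U c where U: "\<And>i. U i \<in> sets borel" "\<And>i. bounded (U i)" "disjoint_family U"
      "(\<Union>i<n. U i) = cube" "\<And>i. U i \<subseteq> cball (c i) e" "\<And>i. i < n \<Longrightarrow> vol (U i) \<le> d"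
    using fine_partition[OF compact_cbox assms(3,4)] by metis
  define V where "V i = {y. y - c i \<in> thicken e K} - U i" for i
  have KB: "thicken e K \<in> sets borel" "bounded (thicken e K)"
    using compact_infdist_le[OF K(2,1) \<open>0 < e\<close>] by (auto simp: borel_compact compact_imp_bounded)
  have tr: "{y. y - c i \<in> thicken e K} \<in> sets borel" "bounded {y. y - c i \<in> thicken e K}" for i
    by (rule sets_translate[OF KB(1)], rule bounded_translate[OF KB(2)])
  have V: "V i \<in> sets borel" "bounded (V i)" "U i \<inter> V i = {}" for i
    using tr(1)[of i] bounded_subset[OF tr(2)[of i], of "V i"] U(1) by (auto simp: V_def)
  have volV: "vol (V i) \<le> vol (thicken e K)" for i
  proof -
    have "vol (V i) \<le> vol {y. y - c i \<in> thicken e K}"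
      using V tr by (intro measure_mono_fmeasurable fmeasurable_bounded) (auto simp: V_def sets_\<Lambda>)
    then show ?thesis using vol_translate[OF KB] by simp
  qed
  let ?E = "\<lambda>i. {S \<in> space P. card (S \<inter> U i) = 1 \<and> S \<inter> V i = {}}"
  have E: "?E i \<in> events" for i by (rule events_count_void[OF U(1,2) V(1,2)])
  have prob_E: "emeasure P (?E i) = ennreal (vol (U i) * exp (- vol (U i)) * exp (- vol (V i)))" for i
    unfolding emeasure_eq_measure prob_count_void[OF U(1,2) V] prob_count[OF U(1,2)] prob_void[OF V(1,2)] by simp
  have cell: "indicator (?E i) S \<le> (of_nat (card (isolated K S \<inter> U i)) :: ennreal)"
    if S: "S \<in> space P" for S i
  proof (cases "S \<in> ?E i")
    case True
    then obtain x where x: "S \<inter> U i = {x}" and void: "S \<inter> V i = {}" by (auto simp: card_1_singleton_iff)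
    have "z = x" if z: "z \<in> S" "z - x \<in> K" for z
    proof -
      have "x - c i + (z - x) \<in> thicken e K"
        using U(5)[of i] x by (intro thicken_shift z) (auto simp: dist_commute)
      then have "z \<in> U i" using void z by (auto simp: V_def)
      with z x show ?thesis by auto
    qed
    then have "isolated K S \<inter> U i = {x}" using x by (auto simp: isolated_def)
    then show ?thesis by (simp add: indicator_def)
  qed simp
  have "ennreal (vol cube * exp (- d - vol (thicken e K))) =
      (\<Sum>i<n. ennreal (vol (U i) * exp (- d - vol (thicken e K))))"
    by (simp add: sum_distrib_right[symmetric] vol_partition[OF U(3,1,2), symmetric] U(4))
  also have "\<dots> \<le> (\<Sum>i<n. ennreal (vol (U i) * exp (- vol (U i)) * exp (- vol (V i))))"
  proof (intro sum_mono ennreal_leI)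
    fix i assume "i \<in> {..<n}"
    then have "- d - vol (thicken e K) \<le> - vol (U i) + - vol (V i)"
      using U(6)[of i] volV[of i] by simp
    then show "vol (U i) * exp (- d - vol (thicken e K)) \<le> vol (U i) * exp (- vol (U i)) * exp (- vol (V i))"
      unfolding mult.assoc exp_add[symmetric] by (intro mult_left_mono) auto
  qed
  also have "\<dots> = (\<Sum>i<n. \<integral>\<^sup>+ S. indicator (?E i) S \<partial>P)"
    by (simp only: nn_integral_indicator[OF E] prob_E)
  also have "\<dots> = (\<integral>\<^sup>+ S. (\<Sum>i<n. indicator (?E i) S) \<partial>P)"
    using E by (intro nn_integral_sum[symmetric]) auto
  also have "\<dots> \<le> (\<integral>\<^sup>+ S. of_nat (card (isolated K S \<inter> cube)) \<partial>P)"
  proof (rule nn_integral_mono)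
    fix S assume S: "S \<in> space P"
    have "card (isolated K S \<inter> cube) = (\<Sum>i<n. card (isolated K S \<inter> U i))"
      unfolding U(4)[symmetric]
      by (rule card_partition[OF U(3), where S = S]) (use finite_Int[OF S, of cube] in \<open>auto simp: U(4) isolated_def\<close>)
    then show "(\<Sum>i<n. indicator (?E i) S) \<le> (of_nat (card (isolated K S \<inter> cube)) :: ennreal)"
      by (simp only: of_nat_sum) (intro sum_mono cell[OF S])
  qed
  finally show ?thesis .
qed

end

section \<open>Avoidance probabilities under the reduced Palm law\<close>

locale stationary_poisson_law_pos = stationary_poisson_law +
  assumes intensity_pos: "0 < intensity P"
begin

lemma vol_cube_pos: "0 < vol cube"
  using intensity_pos by (simp add: intensity_eq_vol)

sublocale palm: prob_space "palm P"
  using intensity_pos by (intro prob_space_palm sets_P) (auto simp: intensity_eq_vol)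

lemma space_palm: "space (palm P) = space configs"
  by (rule sets_eq_imp_space_eq[OF sets_palm])

definition palm_void :: "'a set \<Rightarrow> 'a set set" where
  "palm_void K = {S \<in> space configs. (S - {0}) \<inter> K = {}}"

lemma palm_void_events:
  assumes "K \<in> sets borel" "bounded K"
  shows "palm_void K \<in> palm.events"
proof -
  have "palm_void K = {S \<in> space configs. S \<inter> (K - {0}) = {}}" by (auto simp: palm_void_def)
  also have "\<dots> \<in> sets configs" using assms by (intro sets_void_configs) (auto intro: bounded_subset)
  finally show ?thesis by (simp add: sets_palm)
qed

lemma nn_integral_isolated:
  assumes "K \<in> sets borel" "bounded K"
  shows "(\<integral>\<^sup>+ S. of_nat (card (isolated K S \<inter> cube)) \<partial>P) = ennreal (vol cube * palm.prob (palm_void K))"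
proof -
  have eq: "{x \<in> S \<inter> cube. (\<lambda>y. y - x) ` S \<in> palm_void K} = isolated K S \<inter> cube" if "S \<in> space P" for S
    using that by (auto simp: palm_void_def isolated_def space_P space_configs locally_finite_translate)
  have "emeasure (palm P) (palm_void K) = (\<integral>\<^sup>+ S. of_nat (card (isolated K S \<inter> cube)) \<partial>P) / intensity P"
    unfolding emeasure_palm[OF sets_P palm_void_events[OF assms, unfolded sets_palm]]
    by (intro arg_cong[where f = "\<lambda>I. I / intensity P"] nn_integral_cong) (simp only: eq)
  then have "intensity P * emeasure (palm P) (palm_void K) = (\<integral>\<^sup>+ S. of_nat (card (isolated K S \<inter> cube)) \<partial>P)"
    using vol_cube_pos mult_divide_eq_ennreal[of "ennreal (vol cube)"]
    by (simp add: intensity_eq_vol ennreal_times_divide mult.commute[of "ennreal (vol cube)"])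
  then show ?thesis
    by (simp add: intensity_eq_vol palm.emeasure_eq_measure ennreal_mult')
qed

text \<open>The part of Slivnyak's theorem that the \<open>J\<close> function sees: the two-sided bounds, as cell mass
  and thickening tend to \<open>0\<close>.\<close>

lemma palm_prob_void:
  assumes K: "compact K" "K \<noteq> {}"
  shows "palm.prob (palm_void K) = exp (- vol K)"
proof (rule antisym)
  let ?T = "\<lambda>n. thicken (1 / real (Suc n)) K"
  have T: "?T n \<in> sets borel" "bounded (?T n)" for n
    using compact_infdist_le[OF K(2,1), of "1 / real (Suc n)"] by (auto simp: borel_compact compact_imp_bounded)
  have KB: "K \<in> sets borel" "bounded K" using K by (auto simp: borel_compact compact_imp_bounded)
  have up: "palm.prob (palm_void (?T n)) \<le> exp (- vol K)" for n
  proof (rule tendsto_lowerbound)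
    show "((\<lambda>d. exp (d - vol K)) \<longlongrightarrow> exp (- vol K)) (at_right 0)"
      by (auto intro!: tendsto_eq_intros)
    have "palm.prob (palm_void (?T n)) \<le> exp (d - vol K)" if "0 < d" for d
    proof -
      have "ennreal (vol cube * palm.prob (palm_void (?T n))) \<le> ennreal (vol cube * exp (d - vol K))"
        using nn_integral_isolated_le[OF K(1) _ that, of "1 / real (Suc n)"] by (simp only: nn_integral_isolated[OF T]) simp
      then show ?thesis using vol_cube_pos by (simp add: ennreal_le_iff)
    qed
    then show "\<forall>\<^sub>F d in at_right 0. palm.prob (palm_void (?T n)) \<le> exp (d - vol K)"
      by (auto intro: eventually_mono[OF eventually_at_right_less])
  qed simp
  have "incseq (\<lambda>n. palm_void (?T n))"
    using decseq_thicken[of K] by (fastforce simp: incseq_def decseq_def palm_void_def)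
  then have "(\<lambda>n. palm.prob (palm_void (?T n))) \<longlonglongrightarrow> palm.prob (\<Union>n. palm_void (?T n))"
    using palm_void_events[OF T] by (intro palm.finite_Lim_measure_incseq) auto
  moreover have "(\<Union>n. palm_void (?T n)) = palm_void K"
  proof
    show "(\<Union>n. palm_void (?T n)) \<subseteq> palm_void K" by (auto simp: palm_void_def)
    \<comment> \<open>Only finitely many points of \<open>S\<close> lie in the bounded set \<open>?T 0\<close>, and each of them has positive
      distance from \<open>K\<close>.\<close>
    show "palm_void K \<subseteq> (\<Union>n. palm_void (?T n))"
    proof
      fix S assume S: "S \<in> palm_void K"
      have "finite (S \<inter> ?T 0)" using S T(2)[of 0] by (simp add: palm_void_def space_configs locally_finite_bounded)
      then have "finite ((S - {0}) \<inter> ?T 0)" by (rule finite_subset[rotated]) auto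
      moreover have "\<forall>\<^sub>F n in sequentially. x \<notin> ?T n" if "x \<in> (S - {0}) \<inter> ?T 0" for x
      proof -
        have "x \<notin> K" using S that by (auto simp: palm_void_def)
        then obtain m where "x \<notin> ?T m" using INT_thicken[OF K] by blast
        then have "x \<notin> ?T n" if "m \<le> n" for n using decseqD[OF decseq_thicken that, of K] by blast
        then show ?thesis by (rule eventually_sequentiallyI)
      qed
      ultimately have "\<forall>\<^sub>F n in sequentially. \<forall>x\<in>(S - {0}) \<inter> ?T 0. x \<notin> ?T n"
        by (intro eventually_ball_finite) auto
      then obtain n where "\<forall>x\<in>(S - {0}) \<inter> ?T 0. x \<notin> ?T n"
        using eventually_happens'[OF sequentially_bot] by blast
      moreover have "?T n \<subseteq> ?T 0" by (rule decseqD[OF decseq_thicken]) simp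
      ultimately have "(S - {0}) \<inter> ?T n = {}" by blast
      then show "S \<in> (\<Union>n. palm_void (?T n))" using S by (auto simp: palm_void_def)
    qed
  qed
  ultimately show "palm.prob (palm_void K) \<le> exp (- vol K)"
    using up by (intro LIMSEQ_le_const2) auto
  have low: "exp (- d - vol (?T n)) \<le> palm.prob (palm_void K)" if "0 < d" for d n
  proof -
    have "ennreal (vol cube * exp (- d - vol (?T n))) \<le> ennreal (vol cube * palm.prob (palm_void K))"
      using nn_integral_isolated_ge[OF K _ that, of "1 / real (Suc n)"] by (simp only: nn_integral_isolated[OF KB]) simp
    then show ?thesis using vol_cube_pos by (simp add: ennreal_le_iff)
  qed
  have "(\<lambda>n. vol (?T n)) \<longlonglongrightarrow> vol (\<Inter>n. ?T n)"
    using decseq_thicken[of K] T(1) fmeasurableD2[OF fmeasurable_bounded[OF T]]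
    by (intro Lim_measure_decseq) (auto simp: sets_\<Lambda>)
  then have "(\<lambda>n. exp (- (1 / real (Suc n)) - vol (?T n))) \<longlonglongrightarrow> exp (- 0 - vol K)"
    unfolding INT_thicken[OF K]
    using LIMSEQ_inverse_real_of_nat
    by (intro tendsto_exp tendsto_diff tendsto_minus) (auto simp: inverse_eq_divide)
  then show "exp (- vol K) \<le> palm.prob (palm_void K)"
    using low by (intro LIMSEQ_le_const2[where X = "\<lambda>n. exp (- (1 / real (Suc n)) - vol (?T n))"]) auto
qed

section \<open>The window based J function\<close>

lemma hit_F_eq:
  assumes "compact K"
  shows "hit_F P K = 1 - exp (- vol K)"
proof -
  have KB: "K \<in> sets borel" "bounded K" using assms by (auto simp: borel_compact compact_imp_bounded)
  have "hit_F P K = prob (space P - {S \<in> space P. S \<inter> K = {}})"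
    unfolding hit_F_def by (rule arg_cong[where f = prob]) auto
  then show ?thesis using prob_compl[OF events_void[OF KB]] by (simp add: prob_void[OF KB])
qed

lemma hit_G_eq:
  assumes "compact K" "K \<noteq> {}"
  shows "hit_G P K = 1 - exp (- vol K)"
proof -
  have KB: "K \<in> sets borel" "bounded K" using assms by (auto simp: borel_compact compact_imp_bounded)
  have m: "(\<lambda>S. S - {0}) \<in> measurable (palm P) configs"
    using measurable_remove_point measurable_cong_sets[OF sets_palm refl] by blast
  have "{S \<in> space configs. S \<inter> K \<noteq> {}} = space configs - {S \<in> space configs. S \<inter> K = {}}" by auto
  then have "{S \<in> space configs. S \<inter> K \<noteq> {}} \<in> sets configs" using sets_void_configs[OF KB] by simp
  then have "hit_G P K = palm.prob ((\<lambda>S. S - {0}) -` {S \<in> space configs. S \<inter> K \<noteq> {}} \<inter> space (palm P))"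
    unfolding hit_G_def reduced_palm_def by (simp add: measure_distr[OF m])
  also have "(\<lambda>S. S - {0}) -` {S \<in> space configs. S \<inter> K \<noteq> {}} \<inter> space (palm P) = space (palm P) - palm_void K"
    using measurable_space[OF m] by (auto simp: palm_void_def space_palm)
  also have "palm.prob \<dots> = 1 - exp (- vol K)"
    using palm.prob_compl[OF palm_void_events[OF KB]] by (simp add: palm_prob_void[OF assms])
  finally show ?thesis .
qed

text \<open>The windows are the sections of one closed set in the product space, so this is part of Fubini's
  theorem. Without measurability the Bochner integrals in \<open>J\<close> would be \<open>0\<close> by convention.\<close>

lemma borel_measurable_vol_window:
  assumes "compact W"
  shows "(\<lambda>x. vol (cball 0 r \<inter> (\<lambda>y. y - x) ` W)) \<in> borel_measurable borel"
proof -
  interpret \<Lambda>: sigma_finite_measure \<Lambda>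
  proof
    show "\<exists>A. countable A \<and> A \<subseteq> sets \<Lambda> \<and> \<Union>A = space \<Lambda> \<and> (\<forall>a\<in>A. emeasure \<Lambda> a \<noteq> \<infinity>)"
      using compact_finite[OF compact_cball] real_arch_simple
      by (intro exI[of _ "range (\<lambda>n. cball 0 (real n))"]) (auto simp: sets_\<Lambda> space_\<Lambda> less_top)
  qed
  define Q where "Q = {p :: 'a \<times> 'a. snd p \<in> cball 0 r \<and> snd p + fst p \<in> W}"
  have "closed Q"
    unfolding Q_def using compact_imp_closed[OF assms]
    by (intro closed_Collect_conj closed_vimage[unfolded vimage_def]) (auto intro!: continuous_intros)
  then have "Q \<in> sets (borel \<Otimes>\<^sub>M borel)" unfolding borel_prod by simp
  then have "Q \<in> sets (borel \<Otimes>\<^sub>M \<Lambda>)"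
    using sets_pair_measure_cong[OF refl sets_\<Lambda>] by blast
  then have "(\<lambda>x. enn2real (emeasure \<Lambda> (Pair x -` Q))) \<in> borel_measurable borel"
    by (intro borel_measurable_enn2real \<Lambda>.measurable_emeasure_Pair)
  moreover have "Pair x -` Q = cball 0 r \<inter> (\<lambda>y. y - x) ` W" for x
    by (force simp: Q_def image_iff)
  ultimately show ?thesis by (simp add: measure_def)
qed

text \<open>For \<open>x \<in> W\<close> and \<open>r \<ge> 0\<close> the set \<open>cball 0 r \<inter> (W - x)\<close> contains the origin, so it is a non-empty
  compact set and both integrands equal \<open>exp (- vol (cball 0 r \<inter> (W - x)))\<close>.\<close>

lemma J_window_eq_1:
  assumes W: "compact W" "interior W \<noteq> {}" and r: "0 \<le> r"
  shows "J_window P W r = 1"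
proof -
  let ?K = "\<lambda>x. cball 0 r \<inter> (\<lambda>y. y - x) ` W"
  have K: "compact (?K x)" for x
    using compact_translation_subtract[OF W(1), of x] by (simp add: compact_Int)
  have K0: "?K x \<noteq> {}" if "x \<in> W" for x using that r by force
  have WB: "W \<in> sets borel" "bounded W" using W by (auto simp: borel_compact compact_imp_bounded)
  have num: "(LINT x:W|lborel. 1 - hit_G P (?K x)) = (LINT x:W|lborel. exp (- vol (?K x)))"
    using WB by (intro set_lebesgue_integral_cong) (auto simp: hit_G_eq[OF K K0])
  have den: "(LINT x:W|lborel. 1 - hit_F P (?K x)) = (LINT x:W|lborel. exp (- vol (?K x)))"
    using WB by (intro set_lebesgue_integral_cong) (auto simp: hit_F_eq[OF K])
  have fin: "emeasure lborel W < \<infinity>" using emeasure_bounded_finite[OF WB(2)] .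
  have const: "set_integrable lborel W (\<lambda>x. c)" for c :: real
    using fin WB by (auto simp: set_integrable_def)
  have int: "set_integrable lborel W (\<lambda>x. exp (- vol (?K x)))"
  proof (rule set_integrable_bound[OF const[of 1]])
    have "(\<lambda>x. exp (- vol (?K x))) \<in> borel_measurable lborel"
      using borel_measurable_vol_window[OF W(1), of r] by measurable
    then show "set_borel_measurable lborel W (\<lambda>x. exp (- vol (?K x)))"
      using WB unfolding set_borel_measurable_def by (intro borel_measurable_scaleR) auto
  qed auto
  \<comment> \<open>The common integral is positive, so the quotient is not the conventional \<open>0 / 0 = 0\<close>.\<close>
  obtain a s where a: "0 < s" "ball a s \<subseteq> W"
    using W(2) by (auto simp: mem_interior)
  have "0 < measure lborel (ball a s)" using content_ball_pos[OF a(1)] by simp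
  also have "\<dots> \<le> measure lborel W"
    using a fin WB by (intro measure_mono_fmeasurable) (auto simp: fmeasurable_def)
  finally have "0 < measure lborel W * exp (- vol (cball 0 r))" by simp
  also have "\<dots> = (LINT x:W|lborel. exp (- vol (cball 0 r)))"
    using fin WB by (simp add: set_lebesgue_integral_def)
  also have "\<dots> \<le> (LINT x:W|lborel. exp (- vol (?K x)))"
  proof (rule set_integral_mono[OF const int])
    fix x
    have "vol (?K x) \<le> vol (cball 0 r)"
      using K by (intro measure_mono_fmeasurable fmeasurable_bounded) (auto simp: sets_\<Lambda> borel_compact)
    then show "exp (- vol (cball 0 r)) \<le> exp (- vol (?K x))" by simp
  qed
  finally show ?thesis unfolding J_window_def num den by simp
qed

end

theorem proposition1:
  fixes M :: "'w measure" and X :: "'w \<Rightarrow> 'a::euclidean_space set"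
    and W :: "'a set" and r :: real
  assumes "point_process M X"
    and "stationary M X"
    and "0 < intensity (law M X)" and "intensity (law M X) < \<infinity>"
    and "poisson_process M X"
    and "compact W" and "interior W \<noteq> {}"
    and "0 \<le> r"
  shows "J_window (law M X) W r = 1"
proof -
  let ?P = "law M X"
  interpret M: prob_space M using assms(1) by (simp add: point_process_def)
  have X: "X \<in> measurable M configs" using assms(1) by (simp add: point_process_def)
  have Xfin: "finite (X \<omega> \<inter> B)" if "\<omega> \<in> space M" "bounded B" for \<omega> B
    using measurable_space[OF X that(1)] that(2) by (simp add: space_configs locally_finite_bounded)
  note poisson = assms(5)[unfolded poisson_process_def, THEN conjunct2]
  obtain \<Lambda> :: "'a measure" where \<Lambda>: "sets \<Lambda> = sets borel" "\<And>K. compact K \<Longrightarrow> emeasure \<Lambda> K < \<infinity>"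
      "\<And>B k. B \<in> sets borel \<Longrightarrow> bounded B \<Longrightarrow>
         measure M {\<omega> \<in> space M. card (X \<omega> \<inter> B) = k} = measure \<Lambda> B ^ k / fact k * exp (- measure \<Lambda> B)"
    using poisson[THEN conjunct1] by (elim exE conjE) (rule that; simp)
  have indep: "M.indep_vars (\<lambda>_. count_space UNIV) (\<lambda>i \<omega>. card (X \<omega> \<inter> B i)) I"
    if "finite I" "\<And>i. i \<in> I \<Longrightarrow> B i \<in> sets borel \<and> bounded (B i)" "disjoint_family_on B I"
    for I :: "nat set" and B
    by (rule poisson[THEN conjunct2, rule_format]) (use that in auto)
  have law: "measure ?P {S \<in> space ?P. Q S} = measure M {\<omega> \<in> space M. Q (X \<omega>)}"
    if "{S \<in> space configs. Q S} \<in> sets configs" for Q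
  proof -
    have "X -` {S \<in> space configs. Q S} \<inter> space M = {\<omega> \<in> space M. Q (X \<omega>)}"
      using measurable_space[OF X] by auto
    then show ?thesis using measure_distr[OF X that] by simp
  qed
  interpret stationary_poisson_law_pos ?P \<Lambda>
  proof (intro stationary_poisson_law_pos.intro stationary_poisson_law.intro
      stationary_poisson_law_axioms.intro stationary_poisson_law_pos_axioms.intro)
    show "prob_space ?P" by (rule M.prob_space_distr[OF X])
    show "measure ?P {S \<in> space ?P. card (S \<inter> B) = k} = measure \<Lambda> B ^ k / fact k * exp (- measure \<Lambda> B)"
      if "B \<in> sets borel" "bounded B" for B k
      using law[OF sets_counts_configs[OF that]] \<Lambda>(3)[OF that] by simp
    show "measure ?P {S \<in> space ?P. card (S \<inter> U) = k \<and> S \<inter> V = {}} =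
        measure ?P {S \<in> space ?P. card (S \<inter> U) = k} * measure ?P {S \<in> space ?P. S \<inter> V = {}}"
      if UV: "U \<in> sets borel" "bounded U" "V \<in> sets borel" "bounded V" "U \<inter> V = {}" for U V k
    proof -
      define B where "B i = (if i = 0 then U else V)" for i :: nat
      have "M.indep_vars (\<lambda>_. count_space UNIV) (\<lambda>i \<omega>. card (X \<omega> \<inter> B i)) {0, 1}"
        using UV by (intro indep) (auto simp: B_def disjoint_family_on_def)
      from M.indep_varsD_finite[OF this, of "\<lambda>i. if i = 0 then {k} else {0}"]
      have "measure M (\<Inter>i\<in>{0, 1}. (\<lambda>\<omega>. card (X \<omega> \<inter> B i)) -` (if i = 0 then {k} else {0}) \<inter> space M) =
          (\<Prod>i\<in>{0, 1}. measure M ((\<lambda>\<omega>. card (X \<omega> \<inter> B i)) -` (if i = 0 then {k} else {0}) \<inter> space M))"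
        by simp
      also have "(\<Inter>i\<in>{0, 1}. (\<lambda>\<omega>. card (X \<omega> \<inter> B i)) -` (if i = 0 then {k} else {0}) \<inter> space M) =
          {\<omega> \<in> space M. card (X \<omega> \<inter> U) = k \<and> X \<omega> \<inter> V = {}}"
        using Xfin[OF _ UV(4)] by (auto simp: B_def)
      also have "(\<Prod>i\<in>{0, 1}. measure M ((\<lambda>\<omega>. card (X \<omega> \<inter> B i)) -` (if i = 0 then {k} else {0}) \<inter> space M)) =
          measure M ((\<lambda>\<omega>. card (X \<omega> \<inter> U)) -` {k} \<inter> space M) * measure M ((\<lambda>\<omega>. card (X \<omega> \<inter> V)) -` {0} \<inter> space M)"
        by (simp add: B_def)
      also have "(\<lambda>\<omega>. card (X \<omega> \<inter> U)) -` {k} \<inter> space M = {\<omega> \<in> space M. card (X \<omega> \<inter> U) = k}" by auto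
      also have "(\<lambda>\<omega>. card (X \<omega> \<inter> V)) -` {0} \<inter> space M = {\<omega> \<in> space M. X \<omega> \<inter> V = {}}"
        using Xfin[OF _ UV(4)] by auto
      finally have main: "measure M {\<omega> \<in> space M. card (X \<omega> \<inter> U) = k \<and> X \<omega> \<inter> V = {}} =
          measure M {\<omega> \<in> space M. card (X \<omega> \<inter> U) = k} * measure M {\<omega> \<in> space M. X \<omega> \<inter> V = {}}" .
      have "{S \<in> space configs. card (S \<inter> U) = k \<and> S \<inter> V = {}} =
          {S \<in> space configs. card (S \<inter> U) = k} \<inter> {S \<in> space configs. S \<inter> V = {}}" by auto
      then have "{S \<in> space configs. card (S \<inter> U) = k \<and> S \<inter> V = {}} \<in> sets configs"
        using sets_counts_configs[OF UV(1,2)] sets_void_configs[OF UV(3,4)] by simp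
      then show ?thesis
        using main law[OF sets_counts_configs[OF UV(1,2)]] law[OF sets_void_configs[OF UV(3,4)]] law by simp
    qed
    show "measure ?P {S \<in> space ?P. S \<inter> {y. y - t \<in> B} = {}} = measure ?P {S \<in> space ?P. S \<inter> B = {}}"
      if B: "B \<in> sets borel" "bounded B" for B t
    proof -
      let ?X = "\<lambda>\<omega>. (\<lambda>y. y + (- t)) ` X \<omega>"
      have "(\<lambda>\<omega>. (X \<omega>, t)) \<in> measurable M (configs \<Otimes>\<^sub>M borel)" using X by measurable
      from measurable_compose[OF this measurable_translate_configs]
      have Y: "?X \<in> measurable M configs" by simp
      have "measure ?P {S \<in> space ?P. S \<inter> {y. y - t \<in> B} = {}} = measure M {\<omega> \<in> space M. X \<omega> \<inter> {y. y - t \<in> B} = {}}"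
        by (rule law[OF sets_void_configs[OF sets_translate[OF B(1)] bounded_translate[OF B(2)]]])
      also have "{\<omega> \<in> space M. X \<omega> \<inter> {y. y - t \<in> B} = {}} = ?X -` {S \<in> space configs. S \<inter> B = {}} \<inter> space M"
        using measurable_space[OF Y] by auto
      also have "measure M \<dots> = measure (law M ?X) {S \<in> space configs. S \<inter> B = {}}"
        by (rule measure_distr[OF Y sets_void_configs[OF B], symmetric])
      also have "law M ?X = ?P" using assms(2) by (simp only: stationary_def)
      finally show ?thesis by simp
    qed
  qed (use \<Lambda> assms(3) in auto)
  show ?thesis using assms by (intro J_window_eq_1)
qed

end
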